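(* Let $F$ be a field. If $A$ is a two-sided zero product determined $F$-algebra, then every derivation $\delta:A\to A$ has image contained in the linear span of the elements of $A$ whose square is $0$.
   Context: $F$ is an arbitrary field; an algebra means an associative $F$-algebra with unity $1$. An algebra $A$ is two-sided zero product determined (2-zpd) if every bilinear functional $\varphi:A\times A\to F$ with the property that for all $x,y\in A$, $xy=yx=0$ implies $\varphi(x,y)=0$, is of the form $\varphi(x,y)=\tau_1(xy)+\tau_2(yx)$ (for all $x,y\in A$) for some linear functionals $\tau_1,\tau_2$ on $A$. A derivation $\delta:A\to A$ is an $F$-linear map with $\delta(xy)=\delta(x)y+x\delta(y)$ for all $x,y\in A$. *)

theory Defs
  imports Complex_Main
begin

(* The sort {ring, monoid_mult} is used instead of ring_1 because ring_1 would
   impose 0 \<noteq> 1 and hence exclude the zero algebra. *)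
locale unital_algebra = vector_space scale
  for scale :: "'f::field \<Rightarrow> 'a::{ring,monoid_mult} \<Rightarrow> 'a"  (infixr \<open>*s\<close> 75) +
  assumes scale_mult_left: "(c *s x) * y = c *s (x * y)"
    and scale_mult_right: "x * (c *s y) = c *s (x * y)"
begin

definition linear_functional :: "('a \<Rightarrow> 'f) \<Rightarrow> bool" where
  "linear_functional \<tau> \<longleftrightarrow> Vector_Spaces.linear scale (*) \<tau>"

definition bilinear_functional :: "('a \<Rightarrow> 'a \<Rightarrow> 'f) \<Rightarrow> bool" where
  "bilinear_functional \<phi> \<longleftrightarrow>
     (\<forall>x. linear_functional (\<lambda>y. \<phi> x y)) \<and> (\<forall>y. linear_functional (\<lambda>x. \<phi> x y))"

definition two_sided_zpd :: bool where
  "two_sided_zpd \<longleftrightarrow>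
     (\<forall>\<phi>. bilinear_functional \<phi> \<longrightarrow>
        (\<forall>x y. x * y = 0 \<and> y * x = 0 \<longrightarrow> \<phi> x y = 0) \<longrightarrow>
        (\<exists>\<tau>\<^sub>1 \<tau>\<^sub>2. linear_functional \<tau>\<^sub>1 \<and> linear_functional \<tau>\<^sub>2 \<and>
           (\<forall>x y. \<phi> x y = \<tau>\<^sub>1 (x * y) + \<tau>\<^sub>2 (y * x))))"

definition derivation :: "('a \<Rightarrow> 'a) \<Rightarrow> bool" where
  "derivation \<delta> \<longleftrightarrow>
     Vector_Spaces.linear scale scale \<delta> \<and> (\<forall>x y. \<delta> (x * y) = \<delta> x * y + x * \<delta> y)"

end

end

theory Submission
  imports Defs
begin

text \<open>
  If \<open>xy = yx = 0\<close>, then \<open>\<delta>(x)y = - x\<delta>(y)\<close> and \<open>y\<delta>(x) = - \<delta>(y)x\<close>, so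
  \<open>(\<delta>(x)y)\<^sup>2 = - \<delta>(x)\<delta>(y)xy = 0\<close>. Hence for any functional \<open>f\<close> that vanishes on the
  square-zero elements, the form \<open>\<phi>(x,y) = f(\<delta>(x)y)\<close> can be written as
  \<open>\<tau>\<^sub>1(xy) + \<tau>\<^sub>2(yx)\<close>. Therefore \<open>\<phi>(x,1) = \<phi>(1,x)\<close>, that is,
  \<open>f(\<delta>(x)) = f(\<delta>(1)x) = 0\<close>. As functionals separate points from
  subspaces, \<open>\<delta>(x)\<close> lies in the span.
\<close>

text \<open>Adjoining \<open>v\<close> to a basis of \<open>span S\<close> keeps it independent, so
  a linear map can be prescribed freely there: 1 at \<open>v\<close> and 0 on the basis.\<close>

lemma (in vector_space) exists_functional_separating_span:
  assumes "v \<notin> span S"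
  obtains f where "Vector_Spaces.linear scale (*) f" "f v = 1" "\<And>s. s \<in> S \<Longrightarrow> f s = 0"
proof -
  interpret F: vector_space "(*) :: 'a \<Rightarrow> 'a \<Rightarrow> 'a"
    by unfold_locales (auto simp: algebra_simps)
  interpret vector_space_pair scale "(*) :: 'a \<Rightarrow> 'a \<Rightarrow> 'a" ..
  obtain B where B: "B \<subseteq> S" "independent B" "S \<subseteq> span B"
    using maximal_independent_subset by blast
  have v: "v \<notin> span B"
    using assms span_mono[OF B(1)] by blast
  then have "independent (insert v B)"
    using B(2) by (simp add: independent_insertI)
  then obtain f where lin: "Vector_Spaces.linear scale (*) f"
    and f: "\<forall>b\<in>insert v B. f b = (if b = v then 1 else 0)"
    using linear_independent_extend[of "insert v B" "\<lambda>b. if b = v then 1 else 0"] by blast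
  \<comment> \<open>Here \<open>b \<noteq> v\<close>, because \<open>v\<close> lies outside
    \<open>span B\<close>.\<close>
  have "f b = 0" if "b \<in> B" for b
    using f v that span_base by auto
  then have "f s = 0" if "s \<in> S" for s
    using linear_eq_0_on_span[OF lin] B(3) that by blast
  with lin f show thesis
    using that[of f] by simp
qed

context unital_algebra
begin

lemma derivation_one:
  assumes "derivation \<delta>"
  shows "\<delta> 1 = 0"
proof -
  have "\<delta> (1 * 1) = \<delta> 1 * 1 + 1 * \<delta> 1"
    using assms unfolding derivation_def by blast
  then show ?thesis by simp
qed

lemma derivation_mult_square_zero:
  assumes "derivation \<delta>" and xy: "x * y = 0" and yx: "y * x = 0"
  shows "(\<delta> x * y)\<^sup>2 = 0"
proof -
  have lin: "Vector_Spaces.linear scale scale \<delta>"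
    and Leibniz: "\<And>x y. \<delta> (x * y) = \<delta> x * y + x * \<delta> y"
    using assms(1) by (auto simp: derivation_def)
  interpret Vector_Spaces.linear scale scale \<delta> by (rule lin)
  have 1: "\<delta> x * y = - (x * \<delta> y)"
    using Leibniz[of x y] xy by (simp add: zero eq_neg_iff_add_eq_0)
  have 2: "y * \<delta> x = - (\<delta> y * x)"
    using Leibniz[of y x] yx by (simp add: zero add.commute eq_neg_iff_add_eq_0)
  \<comment> \<open>Regrouping exposes the inner factor \<open>y * \<delta> x\<close>; rewriting it
    by \<open>2\<close> moves \<open>x\<close> next to the last \<open>y\<close>, where
    \<open>x * y = 0\<close>.\<close>
  have "(\<delta> x * y)\<^sup>2 = \<delta> x * (y * \<delta> x) * y"
    by (simp add: power2_eq_square mult.assoc)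
  also have "\<dots> = - (\<delta> x * \<delta> y * (x * y))"
    by (simp add: 2 mult.assoc)
  finally show ?thesis by (simp add: xy)
qed

lemma bilinear_functional_derivation_mult:
  assumes "linear_functional f" and "derivation \<delta>"
  shows "bilinear_functional (\<lambda>x y. f (\<delta> x * y))"
proof -
  interpret f: Vector_Spaces.linear scale "(*)" f
    using assms(1) by (simp add: linear_functional_def)
  interpret d: Vector_Spaces.linear scale scale \<delta>
    using assms(2) by (simp add: derivation_def)
  show ?thesis
    unfolding bilinear_functional_def linear_functional_def
    by (intro conjI allI; unfold_locales)
       (simp_all add: distrib_left distrib_right f.add f.scale d.add d.scale
         scale_mult_left scale_mult_right)
qed

lemma two_sided_zpd_functional_derivation:
  assumes "two_sided_zpd" and "derivation \<delta>" and "linear_functional f"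
    and f0: "\<And>a. a\<^sup>2 = 0 \<Longrightarrow> f a = 0"
  shows "f (\<delta> x) = 0"
proof -
  interpret f: Vector_Spaces.linear scale "(*)" f
    using assms(3) by (simp add: linear_functional_def)
  have "\<forall>x y. x * y = 0 \<and> y * x = 0 \<longrightarrow> f (\<delta> x * y) = 0"
    by (blast intro: f0 derivation_mult_square_zero[OF assms(2)])
  then have "\<exists>\<tau>\<^sub>1 \<tau>\<^sub>2. linear_functional \<tau>\<^sub>1 \<and> linear_functional \<tau>\<^sub>2 \<and>
      (\<forall>x y. f (\<delta> x * y) = \<tau>\<^sub>1 (x * y) + \<tau>\<^sub>2 (y * x))"
    using assms(1)[unfolded two_sided_zpd_def, rule_format,
        OF bilinear_functional_derivation_mult[OF assms(3,2)]] by simp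
  then obtain \<tau>\<^sub>1 \<tau>\<^sub>2 where \<tau>: "\<And>x y. f (\<delta> x * y) = \<tau>\<^sub>1 (x * y) + \<tau>\<^sub>2 (y * x)"
    by blast
  \<comment> \<open>Since 1 commutes with \<open>x\<close>, both sides equal
    \<open>\<tau>\<^sub>1 x + \<tau>\<^sub>2 x\<close>.\<close>
  have "f (\<delta> x) = f (\<delta> 1 * x)"
    using \<tau>[of x 1] \<tau>[of 1 x] by simp
  then show ?thesis
    by (simp add: derivation_one[OF assms(2)] f.zero)
qed

end

theorem corollary3p4:
  fixes scale :: "'f::field \<Rightarrow> 'a::{ring,monoid_mult} \<Rightarrow> 'a"
    and \<delta> :: "'a \<Rightarrow> 'a"
  assumes "unital_algebra scale"
    and "unital_algebra.two_sided_zpd scale"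
    and "unital_algebra.derivation scale \<delta>"
  shows "range \<delta> \<subseteq> module.span scale {a. a\<^sup>2 = 0}"
proof -
  interpret unital_algebra scale by fact
  have "\<delta> x \<in> span {a. a\<^sup>2 = 0}" for x
  proof (rule ccontr)
    assume "\<delta> x \<notin> span {a. a\<^sup>2 = 0}"
    \<comment> \<open>This \<open>f\<close> kills every square-zero element, so
      \<open>two_sided_zpd_functional_derivation\<close> forces \<open>f (\<delta> x) = 0\<close>,
      against the value 1.\<close>
    then obtain f where "linear_functional f" "f (\<delta> x) = 1" "\<And>a. a\<^sup>2 = 0 \<Longrightarrow> f a = 0"
      unfolding linear_functional_def
      by (rule exists_functional_separating_span) auto
    then show False
      using two_sided_zpd_functional_derivation[OF assms(2,3)] by fastforce
  qed
  then show ?thesis by blast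
qed

end
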